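(* 1. Let $(Q,\circ)$ be an $m$-inverse loop with respect to the permutation $J=I_r$, where $I_r$ is defined by $x\circ I_rx=1$. Then $N_l=N_r=N_m$. 2. In a WIP-loop, ${}_1N^A_l={}_3N^A_l={}_2N^A_m$, ${}_2N^A_r={}_3N^A_r={}_1N^A_m$, and $N_l=N_r=N_m$. 3. In a CI-loop $Q$, ${}_1N^A_l={}_3N^A_l={}_2N^A_m={}_2N^A_r={}_3N^A_r={}_1N^A_m$, and $N_l=N_r=N_m\unlhd Q$.
   Context: A loop is a quasigroup (a non-empty set with a binary operation for which $x\circ a=b$ and $a\circ y=b$ are uniquely solvable) with a two-sided identity element $1$. $\varepsilon$ is the identity permutation. A loop $(Q,\circ)$ is: - $m$-inverse ($m$ an integer) with respect to a permutation $J$ of $Q$ if $J^m(x\circ y)\circ J^{m+1}x=J^my$ for all $x,y$; - a WIP-loop if there is a permutation $J$ of $Q$ with $J(x\circ y)\circ x=Jy$ for all $x,y$; - a CI-loop if there is a permutation $J$ of $Q$ with $(x\circ y)\circ Jx=y$ for all $x,y$. An autotopy is a triple $(\alpha,\beta,\gamma)$ of permutations of $Q$ with $\alpha x\circ\beta y=\gamma(x\circ y)$ for all $x,y$. $N^A_l,N^A_r,N^A_m$ are the groups of autotopies of the forms $(\alpha,\varepsilon,\gamma)$, $(\varepsilon,\beta,\gamma)$, $(\alpha,\beta,\varepsilon)$ respectively; ${}_iN^A_l$, ${}_iN^A_r$, ${}_iN^A_m$ is the group of $i$-th components of their elements. Garrison nuclei: $N_l=\{a:(a\circ x)\circ y=a\circ(x\circ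 y)\ \forall x,y\}$, $N_r=\{a:(x\circ y)\circ a=x\circ(y\circ a)\ \forall x,y\}$, $N_m=\{a:(x\circ a)\circ y=x\circ(a\circ y)\ \forall x,y\}$. $N\unlhd Q$ means that $N$ is a normal subloop of $Q$, i.e. the class containing $1$ of a normal congruence of $(Q,\circ)$ (an equivalence $\theta$ with $x\,\theta\,y\Leftrightarrow(z\circ x)\,\theta\,(z\circ y)\Leftrightarrow(x\circ z)\,\theta\,(y\circ z)$ for all $x,y,z$). *)

theory Defs
  imports "HOL-Combinatorics.Permutations"
begin

locale quasigroup =
  fixes Q :: "'a set" and mul :: "'a \<Rightarrow> 'a \<Rightarrow> 'a"
  assumes nonempty: "Q \<noteq> {}"
    and closed: "\<lbrakk>a \<in> Q; b \<in> Q\<rbrakk> \<Longrightarrow> mul a b \<in> Q"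
    and left_solvable: "\<lbrakk>a \<in> Q; b \<in> Q\<rbrakk> \<Longrightarrow> \<exists>!x. x \<in> Q \<and> mul x a = b"
    and right_solvable: "\<lbrakk>a \<in> Q; b \<in> Q\<rbrakk> \<Longrightarrow> \<exists>!y. y \<in> Q \<and> mul a y = b"

locale loop = quasigroup Q mul
  for Q :: "'a set" and mul :: "'a \<Rightarrow> 'a \<Rightarrow> 'a" +
  fixes e :: 'a
  assumes one_closed: "e \<in> Q"
    and left_one: "x \<in> Q \<Longrightarrow> mul e x = x"
    and right_one: "x \<in> Q \<Longrightarrow> mul x e = x"

text \<open>
  A permutation of \<open>Q\<close> is a function \<open>f\<close> with \<open>f permutes Q\<close>, i.e. a bijection of \<open>Q\<close> extended
  by the identity outside \<open>Q\<close>.  Two such functions are equal iff they agree on \<open>Q\<close>, so that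
  equality of sets of permutations has its usual meaning, and the identity permutation is \<open>id\<close>.
\<close>

text \<open>Integer powers; meaningful when \<open>J\<close> is a bijection of the whole type, in particular when
  \<open>J permutes Q\<close>.\<close>

definition perm_pow :: "('a \<Rightarrow> 'a) \<Rightarrow> int \<Rightarrow> 'a \<Rightarrow> 'a" where
  "perm_pow J m = (if m \<ge> 0 then J ^^ nat m else inv J ^^ nat (- m))"

definition m_inverse_loop ::
  "'a set \<Rightarrow> ('a \<Rightarrow> 'a \<Rightarrow> 'a) \<Rightarrow> 'a \<Rightarrow> int \<Rightarrow> ('a \<Rightarrow> 'a) \<Rightarrow> bool" where
  "m_inverse_loop Q mul e m J \<longleftrightarrow> loop Q mul e \<and> J permutes Q \<and>
     (\<forall>x\<in>Q. \<forall>y\<in>Q. mul (perm_pow J m (mul x y)) (perm_pow J (m + 1) x) = perm_pow J m y)"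

definition WIP_loop :: "'a set \<Rightarrow> ('a \<Rightarrow> 'a \<Rightarrow> 'a) \<Rightarrow> 'a \<Rightarrow> bool" where
  "WIP_loop Q mul e \<longleftrightarrow> loop Q mul e \<and>
     (\<exists>J. J permutes Q \<and> (\<forall>x\<in>Q. \<forall>y\<in>Q. mul (J (mul x y)) x = J y))"

definition CI_loop :: "'a set \<Rightarrow> ('a \<Rightarrow> 'a \<Rightarrow> 'a) \<Rightarrow> 'a \<Rightarrow> bool" where
  "CI_loop Q mul e \<longleftrightarrow> loop Q mul e \<and>
     (\<exists>J. J permutes Q \<and> (\<forall>x\<in>Q. \<forall>y\<in>Q. mul (mul x y) (J x) = y))"

definition right_inverse_map :: "'a set \<Rightarrow> ('a \<Rightarrow> 'a \<Rightarrow> 'a) \<Rightarrow> 'a \<Rightarrow> 'a \<Rightarrow> 'a" where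
  "right_inverse_map Q mul e x = (if x \<in> Q then THE y. y \<in> Q \<and> mul x y = e else x)"

lemma (in loop) right_inverse_map_in:
  assumes "x \<in> Q"
  shows "right_inverse_map Q mul e x \<in> Q" and "mul x (right_inverse_map Q mul e x) = e"
  using theI'[OF right_solvable[OF assms one_closed]] assms
  by (simp_all add: right_inverse_map_def)

lemma (in loop) right_inverse_map_permutes: "right_inverse_map Q mul e permutes Q"
proof (rule bij_imp_permutes)
  let ?I = "right_inverse_map Q mul e"
  have "inj_on ?I Q"
  proof (rule inj_onI)
    fix x y assume "x \<in> Q" "y \<in> Q" "?I x = ?I y"
    then show "x = y"
      using left_solvable[OF right_inverse_map_in(1)[of x] one_closed]
        right_inverse_map_in(2)[of x] right_inverse_map_in(2)[of y] by metis
  qed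
  moreover have "?I ` Q = Q"
  proof
    show "?I ` Q \<subseteq> Q" using right_inverse_map_in(1) by blast
    show "Q \<subseteq> ?I ` Q"
    proof
      fix y assume y: "y \<in> Q"
      then obtain x where x: "x \<in> Q" "mul x y = e"
        using left_solvable[OF y one_closed] by blast
      then have "?I x = y"
        using right_solvable[OF x(1) one_closed] right_inverse_map_in[OF x(1)] y by blast
      then show "y \<in> ?I ` Q" using x(1) by blast
    qed
  qed
  ultimately show "bij_betw ?I Q Q" by (simp add: bij_betw_def)
qed (simp add: right_inverse_map_def)

definition autotopy ::
  "'a set \<Rightarrow> ('a \<Rightarrow> 'a \<Rightarrow> 'a) \<Rightarrow> ('a \<Rightarrow> 'a) \<times> ('a \<Rightarrow> 'a) \<times> ('a \<Rightarrow> 'a) \<Rightarrow> bool" where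
  "autotopy Q mul = (\<lambda>(\<alpha>, \<beta>, \<gamma>). \<alpha> permutes Q \<and> \<beta> permutes Q \<and> \<gamma> permutes Q \<and>
     (\<forall>x\<in>Q. \<forall>y\<in>Q. mul (\<alpha> x) (\<beta> y) = \<gamma> (mul x y)))"

definition left_A_nucleus ::
  "'a set \<Rightarrow> ('a \<Rightarrow> 'a \<Rightarrow> 'a) \<Rightarrow> (('a \<Rightarrow> 'a) \<times> ('a \<Rightarrow> 'a) \<times> ('a \<Rightarrow> 'a)) set" where
  "left_A_nucleus Q mul = {(\<alpha>, \<beta>, \<gamma>). autotopy Q mul (\<alpha>, \<beta>, \<gamma>) \<and> \<beta> = id}"

definition right_A_nucleus ::
  "'a set \<Rightarrow> ('a \<Rightarrow> 'a \<Rightarrow> 'a) \<Rightarrow> (('a \<Rightarrow> 'a) \<times> ('a \<Rightarrow> 'a) \<times> ('a \<Rightarrow> 'a)) set" where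
  "right_A_nucleus Q mul = {(\<alpha>, \<beta>, \<gamma>). autotopy Q mul (\<alpha>, \<beta>, \<gamma>) \<and> \<alpha> = id}"

definition middle_A_nucleus ::
  "'a set \<Rightarrow> ('a \<Rightarrow> 'a \<Rightarrow> 'a) \<Rightarrow> (('a \<Rightarrow> 'a) \<times> ('a \<Rightarrow> 'a) \<times> ('a \<Rightarrow> 'a)) set" where
  "middle_A_nucleus Q mul = {(\<alpha>, \<beta>, \<gamma>). autotopy Q mul (\<alpha>, \<beta>, \<gamma>) \<and> \<gamma> = id}"

definition comp1 :: "('b \<times> 'b \<times> 'b) set \<Rightarrow> 'b set" where
  "comp1 T = (\<lambda>(\<alpha>, \<beta>, \<gamma>). \<alpha>) ` T"

definition comp2 :: "('b \<times> 'b \<times> 'b) set \<Rightarrow> 'b set" where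
  "comp2 T = (\<lambda>(\<alpha>, \<beta>, \<gamma>). \<beta>) ` T"

definition comp3 :: "('b \<times> 'b \<times> 'b) set \<Rightarrow> 'b set" where
  "comp3 T = (\<lambda>(\<alpha>, \<beta>, \<gamma>). \<gamma>) ` T"

definition left_nucleus :: "'a set \<Rightarrow> ('a \<Rightarrow> 'a \<Rightarrow> 'a) \<Rightarrow> 'a set" where
  "left_nucleus Q mul =
     {a \<in> Q. \<forall>x\<in>Q. \<forall>y\<in>Q. mul (mul a x) y = mul a (mul x y)}"

definition right_nucleus :: "'a set \<Rightarrow> ('a \<Rightarrow> 'a \<Rightarrow> 'a) \<Rightarrow> 'a set" where
  "right_nucleus Q mul =
     {a \<in> Q. \<forall>x\<in>Q. \<forall>y\<in>Q. mul (mul x y) a = mul x (mul y a)}"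

definition middle_nucleus :: "'a set \<Rightarrow> ('a \<Rightarrow> 'a \<Rightarrow> 'a) \<Rightarrow> 'a set" where
  "middle_nucleus Q mul =
     {a \<in> Q. \<forall>x\<in>Q. \<forall>y\<in>Q. mul (mul x a) y = mul x (mul a y)}"

definition normal_congruence ::
  "'a set \<Rightarrow> ('a \<Rightarrow> 'a \<Rightarrow> 'a) \<Rightarrow> ('a \<times> 'a) set \<Rightarrow> bool" where
  "normal_congruence Q mul \<theta> \<longleftrightarrow> equiv Q \<theta> \<and>
     (\<forall>x\<in>Q. \<forall>y\<in>Q. \<forall>z\<in>Q.
        ((x, y) \<in> \<theta> \<longleftrightarrow> (mul z x, mul z y) \<in> \<theta>) \<and>
        ((x, y) \<in> \<theta> \<longleftrightarrow> (mul x z, mul y z) \<in> \<theta>))"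

definition normal_subloop ::
  "'a set \<Rightarrow> ('a \<Rightarrow> 'a \<Rightarrow> 'a) \<Rightarrow> 'a \<Rightarrow> 'a set \<Rightarrow> bool" where
  "normal_subloop Q mul e N \<longleftrightarrow> (\<exists>\<theta>. normal_congruence Q mul \<theta> \<and> N = \<theta> `` {e})"

end

theory Submission
  imports Defs
begin

text \<open>
  All three claims rest on one observation.  Let \<open>K\<close> and \<open>H\<close> be permutations of the loop with
  \<open>K (x \<circ> y) \<circ> H x = K y\<close> for all \<open>x\<close>, \<open>y\<close>, and let \<open>H\<close> fix the identity element.  The law says
  that the triple \<open>(x, y, z)\<close> satisfies \<open>x \<circ> y = z\<close> exactly when \<open>(K z, H x, K y)\<close> does, so it
  transports autotopies, and it carries left nuclear elements to middle nuclear ones, and middle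
  nuclear ones to right nuclear ones.  On elements this transport is \<open>H\<close> itself:
  \<open>a \<in> N\<^sub>l \<longleftrightarrow> H a \<in> N\<^sub>m\<close> and \<open>a \<in> N\<^sub>m \<longleftrightarrow> H a \<in> N\<^sub>r\<close>
  (lemmas \<open>left_nucleus_iff_middle\<close> and \<open>middle_nucleus_iff_right\<close>).  Hence the three nuclei
  coincide as soon as \<open>H (N) = N\<close> for each of them.

  A WIP-loop is the case \<open>K = J\<close>, \<open>H = id\<close>, for which the last condition is trivial.  An
  \<open>m\<close>-inverse loop with respect to \<open>I\<^sub>r\<close> is the case \<open>K = I\<^sub>r\<^sup>m\<close>, \<open>H = I\<^sub>r\<^sup>m\<^sup>+\<^sup>1\<close>; here the
  condition holds because \<open>I\<^sub>r\<close> acts on each nucleus as group inversion.  A CI-loop is the case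
  \<open>m = 0\<close>, since its law at \<open>y = 1\<close> forces \<open>J = I\<^sub>r\<close>.

  In every loop the components of the A-nuclei are translations by nuclear elements:
  \<open>(L\<^sub>a, id, L\<^sub>a)\<close> with \<open>a \<in> N\<^sub>l\<close>, \<open>(id, R\<^sub>a, R\<^sub>a)\<close> with \<open>a \<in> N\<^sub>r\<close>, and
  \<open>(R\<^sub>b, L\<^sub>a, id)\<close> with mutually inverse \<open>a, b \<in> N\<^sub>m\<close>.  The equalities between components thus
  follow from those between nuclei, except that the CI case also requires \<open>L\<^sub>a = R\<^sub>a\<close>.  That
  holds because \<open>(a \<circ> x) \<circ> J a = x = (x \<circ> a) \<circ> J a\<close> for nuclear \<open>a\<close>, the second
  equality because \<open>J a = a\<inverse>\<close> is again nuclear.  The nucleus of a CI-loop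
  is therefore central, and its cosets form a normal congruence.
\<close>

section \<open>Nuclei of a loop\<close>

context loop
begin

abbreviation times_Q (infixl "\<cdot>" 70) where "x \<cdot> y \<equiv> mul x y"

lemma left_cancel: "\<lbrakk>a \<in> Q; x \<in> Q; y \<in> Q; a \<cdot> x = a \<cdot> y\<rbrakk> \<Longrightarrow> x = y"
  using right_solvable closed by blast

lemma right_cancel: "\<lbrakk>a \<in> Q; x \<in> Q; y \<in> Q; x \<cdot> a = y \<cdot> a\<rbrakk> \<Longrightarrow> x = y"
  using left_solvable closed by blast

lemma left_divide:
  assumes "a \<in> Q" "b \<in> Q" obtains y where "y \<in> Q" "a \<cdot> y = b"
  using right_solvable assms by blast

lemma right_divide:
  assumes "a \<in> Q" "b \<in> Q" obtains x where "x \<in> Q" "x \<cdot> a = b"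
  using left_solvable assms by blast

abbreviation Nl where "Nl \<equiv> left_nucleus Q mul"
abbreviation Nr where "Nr \<equiv> right_nucleus Q mul"
abbreviation Nm where "Nm \<equiv> middle_nucleus Q mul"
abbreviation Ir where "Ir \<equiv> right_inverse_map Q mul e"

lemma left_nucleusI:
  "a \<in> Q \<Longrightarrow> (\<And>x y. x \<in> Q \<Longrightarrow> y \<in> Q \<Longrightarrow> a \<cdot> x \<cdot> y = a \<cdot> (x \<cdot> y)) \<Longrightarrow> a \<in> Nl"
  by (simp add: left_nucleus_def)

lemma right_nucleusI:
  "a \<in> Q \<Longrightarrow> (\<And>x y. x \<in> Q \<Longrightarrow> y \<in> Q \<Longrightarrow> x \<cdot> y \<cdot> a = x \<cdot> (y \<cdot> a)) \<Longrightarrow> a \<in> Nr"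
  by (simp add: right_nucleus_def)

lemma middle_nucleusI:
  "a \<in> Q \<Longrightarrow> (\<And>x y. x \<in> Q \<Longrightarrow> y \<in> Q \<Longrightarrow> x \<cdot> a \<cdot> y = x \<cdot> (a \<cdot> y)) \<Longrightarrow> a \<in> Nm"
  by (simp add: middle_nucleus_def)

lemma left_nucleusD: "\<lbrakk>a \<in> Nl; x \<in> Q; y \<in> Q\<rbrakk> \<Longrightarrow> a \<cdot> x \<cdot> y = a \<cdot> (x \<cdot> y)"
  by (simp add: left_nucleus_def)

lemma right_nucleusD: "\<lbrakk>a \<in> Nr; x \<in> Q; y \<in> Q\<rbrakk> \<Longrightarrow> x \<cdot> y \<cdot> a = x \<cdot> (y \<cdot> a)"
  by (simp add: right_nucleus_def)

lemma middle_nucleusD: "\<lbrakk>a \<in> Nm; x \<in> Q; y \<in> Q\<rbrakk> \<Longrightarrow> x \<cdot> a \<cdot> y = x \<cdot> (a \<cdot> y)"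
  by (simp add: middle_nucleus_def)

lemma left_nucleus_in: "a \<in> Nl \<Longrightarrow> a \<in> Q"
  by (simp add: left_nucleus_def)

lemma right_nucleus_in: "a \<in> Nr \<Longrightarrow> a \<in> Q"
  by (simp add: right_nucleus_def)

lemma middle_nucleus_in: "a \<in> Nm \<Longrightarrow> a \<in> Q"
  by (simp add: middle_nucleus_def)

lemma right_inverse_map_eqI: "\<lbrakk>x \<in> Q; y \<in> Q; x \<cdot> y = e\<rbrakk> \<Longrightarrow> Ir x = y"
  by (metis left_cancel right_inverse_map_in)

lemma right_inverse_map_one: "Ir e = e"
  by (rule right_inverse_map_eqI) (simp_all add: one_closed left_one)

lemma one_in_left_nucleus: "e \<in> Nl"
  by (rule left_nucleusI) (simp_all add: one_closed left_one closed)

lemma left_nucleus_closed: "a \<in> Nl \<Longrightarrow> b \<in> Nl \<Longrightarrow> a \<cdot> b \<in> Nl"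
  by (rule left_nucleusI) (simp_all add: left_nucleusD left_nucleus_in closed)

text \<open>On each nucleus the right inverse is a two-sided inverse.\<close>

lemma left_nucleus_left_inverse:
  assumes "a \<in> Nl" shows "Ir a \<cdot> a = e"
proof -
  have a: "a \<in> Q" "Ir a \<in> Q" "a \<cdot> Ir a = e"
    using assms left_nucleus_in right_inverse_map_in by auto
  have "a \<cdot> (Ir a \<cdot> a) = a \<cdot> e"
    using left_nucleusD[OF assms a(2,1)] a by (simp add: left_one right_one)
  then show ?thesis using a left_cancel closed one_closed by blast
qed

lemma right_nucleus_left_inverse:
  assumes "a \<in> Nr" shows "Ir a \<cdot> a = e"
proof -
  have a: "a \<in> Q" using assms right_nucleus_in by auto
  obtain b where b: "b \<in> Q" "b \<cdot> a = e" by (rule right_divide[OF a one_closed])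
  have "(a \<cdot> b) \<cdot> a = e \<cdot> a"
    using right_nucleusD[OF assms a b(1)] a b by (simp add: left_one right_one)
  then have "a \<cdot> b = e" using a b right_cancel closed one_closed by blast
  then show ?thesis using right_inverse_map_eqI[OF a b(1)] b by simp
qed

lemma middle_nucleus_left_inverse:
  assumes "a \<in> Nm" shows "Ir a \<cdot> a = e"
proof -
  have a: "a \<in> Q" "Ir a \<in> Q" "a \<cdot> Ir a = e"
    using assms middle_nucleus_in right_inverse_map_in by auto
  obtain b where b: "b \<in> Q" "b \<cdot> a = e" by (rule right_divide[OF a(1) one_closed])
  have "b = Ir a"
    using middle_nucleusD[OF assms b(1) a(2)] a b by (simp add: left_one right_one)
  then show ?thesis using b by simp
qed

lemma right_inverse_map_twice:
  assumes "a \<in> Nl \<or> a \<in> Nr \<or> a \<in> Nm" shows "Ir (Ir a) = a"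
proof -
  have "a \<in> Q" "Ir a \<cdot> a = e"
    using assms left_nucleus_in right_nucleus_in middle_nucleus_in
      left_nucleus_left_inverse right_nucleus_left_inverse middle_nucleus_left_inverse by blast+
  then show ?thesis using right_inverse_map_eqI right_inverse_map_in(1) by blast
qed

text \<open>Each nucleus is closed under inverses.\<close>

lemma left_nucleus_inverse:
  assumes "a \<in> Nl" shows "Ir a \<in> Nl"
proof (rule left_nucleusI)
  have a: "a \<in> Q" "Ir a \<in> Q" "a \<cdot> Ir a = e"
    using assms left_nucleus_in right_inverse_map_in by auto
  then show "Ir a \<in> Q" by simp
  have cancel: "a \<cdot> (Ir a \<cdot> x) = x" if "x \<in> Q" for x
    using left_nucleusD[OF assms a(2) that] a that by (simp add: left_one)
  fix x y assume xy: "x \<in> Q" "y \<in> Q"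
  have "a \<cdot> (Ir a \<cdot> x \<cdot> y) = a \<cdot> (Ir a \<cdot> x) \<cdot> y"
    using left_nucleusD[OF assms] a xy closed by simp
  also have "\<dots> = a \<cdot> (Ir a \<cdot> (x \<cdot> y))"
    using cancel xy closed by simp
  finally show "Ir a \<cdot> x \<cdot> y = Ir a \<cdot> (x \<cdot> y)"
    using left_cancel[OF a(1)] a xy closed by metis
qed

lemma right_nucleus_inverse:
  assumes "a \<in> Nr" shows "Ir a \<in> Nr"
proof (rule right_nucleusI)
  have a: "a \<in> Q" "Ir a \<in> Q" "Ir a \<cdot> a = e"
    using assms right_nucleus_in right_inverse_map_in right_nucleus_left_inverse by auto
  then show "Ir a \<in> Q" by simp
  have cancel: "x \<cdot> Ir a \<cdot> a = x" if "x \<in> Q" for x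
    using right_nucleusD[OF assms that a(2)] a that by (simp add: right_one)
  fix x y assume xy: "x \<in> Q" "y \<in> Q"
  have "x \<cdot> (y \<cdot> Ir a) \<cdot> a = x \<cdot> (y \<cdot> Ir a \<cdot> a)"
    using right_nucleusD[OF assms] a xy closed by simp
  also have "\<dots> = x \<cdot> y \<cdot> Ir a \<cdot> a"
    using cancel xy closed by simp
  finally show "x \<cdot> y \<cdot> Ir a = x \<cdot> (y \<cdot> Ir a)"
    using right_cancel[OF a(1)] a xy closed by metis
qed

lemma middle_nucleus_inverse:
  assumes "a \<in> Nm" shows "Ir a \<in> Nm"
proof (rule middle_nucleusI)
  have a: "a \<in> Q" "Ir a \<in> Q" "a \<cdot> Ir a = e" "Ir a \<cdot> a = e"
    using assms middle_nucleus_in right_inverse_map_in middle_nucleus_left_inverse by auto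
  then show "Ir a \<in> Q" by simp
  fix x y assume xy: "x \<in> Q" "y \<in> Q"
  obtain u where u: "u \<in> Q" "u \<cdot> a = x" by (rule right_divide[OF a(1) xy(1)])
  obtain v where v: "v \<in> Q" "a \<cdot> v = y" by (rule left_divide[OF a(1) xy(2)])
  have "x \<cdot> Ir a = u"
    using middle_nucleusD[OF assms u(1) a(2)] a u by (simp add: right_one)
  moreover have "Ir a \<cdot> y = v"
    using middle_nucleusD[OF assms a(2) v(1)] a v by (simp add: left_one)
  ultimately show "x \<cdot> Ir a \<cdot> y = x \<cdot> (Ir a \<cdot> y)"
    using middle_nucleusD[OF assms u(1) v(1)] u v by simp
qed

section \<open>Transport of nuclei by an inverse law\<close>

text \<open>
  In terms of autotopies, the law turns \<open>(\<alpha>, \<beta>, \<gamma>)\<close> into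
  \<open>(K \<gamma> K\<inverse>, H \<alpha> H\<inverse>, K \<beta> K\<inverse>)\<close>.  Applied to \<open>(L\<^sub>a, id, L\<^sub>a)\<close> this gives an autotopy
  with third component \<open>id\<close> and second component \<open>L\<^sub>c\<close>, where \<open>c = H a\<close>; applied to
  \<open>(R\<^sub>b, L\<^sub>a, id)\<close> it gives one with first component \<open>id\<close> and second component \<open>R\<^sub>d\<close>, where
  \<open>d = H b\<close>.  The next two lemmas carry this out on elements, in both directions.  The key
  intermediate facts are the identities \<open>H (a \<circ> x) = H a \<circ> H x\<close> and
  \<open>H (x \<circ> a) = H x \<circ> H a\<close> for the element \<open>a\<close> in question.
\<close>

lemma left_nucleus_iff_middle:
  assumes K: "K permutes Q" and H: "H permutes Q" and H1: "H e = e"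
    and law: "\<And>x y. x \<in> Q \<Longrightarrow> y \<in> Q \<Longrightarrow> K (x \<cdot> y) \<cdot> H x = K y"
    and a: "a \<in> Q"
  shows "a \<in> Nl \<longleftrightarrow> H a \<in> Nm"
proof
  note in_Q = permutes_in_image[OF K] permutes_in_image[OF H] closed a
  assume "a \<in> Nl"
  show "H a \<in> Nm"
  proof (rule middle_nucleusI)
    \<comment> \<open>Write \<open>w = K (a \<cdot> (x \<cdot> y))\<close> and evaluate the law for \<open>a \<cdot> x\<close>, \<open>x\<close> and \<open>a\<close>.\<close>
    have mult: "w \<cdot> H (a \<cdot> x) = w \<cdot> H a \<cdot> H x" if "w \<in> Q" "x \<in> Q" for w x
    proof -
      obtain t where t: "t \<in> Q" "K t = w"
        using K \<open>w \<in> Q\<close> by (metis permutes_def)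
      obtain z where z: "z \<in> Q" "a \<cdot> z = t" by (rule left_divide[OF a t(1)])
      obtain y where y: "y \<in> Q" "x \<cdot> y = z" by (rule left_divide[OF \<open>x \<in> Q\<close> z(1)])
      have "w \<cdot> H (a \<cdot> x) = K (a \<cdot> x \<cdot> y) \<cdot> H (a \<cdot> x)"
        using left_nucleusD[OF \<open>a \<in> Nl\<close>] that t z y by simp
      also have "\<dots> = K z \<cdot> H x"
        using law[OF \<open>x \<in> Q\<close> y(1)] law[of "a \<cdot> x" y] that y in_Q by simp
      also have "K z = w \<cdot> H a" using law[OF a z(1)] t z by simp
      finally show ?thesis .
    qed
    have hom: "H (a \<cdot> x) = H a \<cdot> H x" if "x \<in> Q" for x
      using mult[OF one_closed that] in_Q that by (simp add: left_one)
    show "H a \<in> Q" using in_Q by simp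
    fix w v assume wv: "w \<in> Q" "v \<in> Q"
    obtain x where x: "x \<in> Q" "H x = v"
      using H \<open>v \<in> Q\<close> by (metis permutes_def)
    show "w \<cdot> H a \<cdot> v = w \<cdot> (H a \<cdot> v)"
      using mult[OF wv(1) x(1)] hom[OF x(1)] x by simp
  qed
next
  note in_Q = permutes_in_image[OF K] permutes_in_image[OF H] closed a one_closed
  assume Ha: "H a \<in> Nm"
  \<comment> \<open>Compare the law at \<open>y = e\<close> for the product with its iteration over the two factors.\<close>
  have hom: "H (a \<cdot> x) = H a \<cdot> H x" if x: "x \<in> Q" for x
  proof -
    have "K (a \<cdot> x) \<cdot> (H a \<cdot> H x) = K (a \<cdot> x) \<cdot> H a \<cdot> H x"
      using middle_nucleusD[OF Ha] in_Q x by simp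
    also have "\<dots> = K (x \<cdot> e) \<cdot> H x" using law a x by (simp add: right_one)
    also have "\<dots> = K e" by (rule law[OF x one_closed])
    also have "\<dots> = K (a \<cdot> x \<cdot> e) \<cdot> H (a \<cdot> x)" using law in_Q x by simp
    also have "\<dots> = K (a \<cdot> x) \<cdot> H (a \<cdot> x)" using in_Q x by (simp add: right_one)
    finally show ?thesis using left_cancel in_Q x by metis
  qed
  show "a \<in> Nl"
  proof (rule left_nucleusI[OF a])
    fix x y assume xy: "x \<in> Q" "y \<in> Q"
    have "K (a \<cdot> (x \<cdot> y)) \<cdot> H (a \<cdot> x) = K (a \<cdot> (x \<cdot> y)) \<cdot> H a \<cdot> H x"
      using middle_nucleusD[OF Ha] hom in_Q xy by simp
    also have "\<dots> = K (a \<cdot> x \<cdot> y) \<cdot> H (a \<cdot> x)" using law in_Q xy by simp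
    finally have "K (a \<cdot> (x \<cdot> y)) = K (a \<cdot> x \<cdot> y)"
      using right_cancel in_Q xy by metis
    then show "a \<cdot> x \<cdot> y = a \<cdot> (x \<cdot> y)" using permutes_inj[OF K] by (metis injD)
  qed
qed

lemma middle_nucleus_iff_right:
  assumes K: "K permutes Q" and H: "H permutes Q" and H1: "H e = e"
    and law: "\<And>x y. x \<in> Q \<Longrightarrow> y \<in> Q \<Longrightarrow> K (x \<cdot> y) \<cdot> H x = K y"
    and a: "a \<in> Q"
  shows "a \<in> Nm \<longleftrightarrow> H a \<in> Nr"
proof
  note in_Q = permutes_in_image[OF K] permutes_in_image[OF H] closed a
  assume "a \<in> Nm"
  show "H a \<in> Nr"
  proof (rule right_nucleusI)
    \<comment> \<open>Write \<open>w = K (x \<cdot> a \<cdot> y)\<close> and evaluate the law for \<open>x \<cdot> a\<close>, \<open>a\<close> and \<open>x\<close>.\<close>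
    have mult: "w \<cdot> H (x \<cdot> a) = w \<cdot> H x \<cdot> H a" if "w \<in> Q" "x \<in> Q" for w x
    proof -
      obtain t where t: "t \<in> Q" "K t = w"
        using K \<open>w \<in> Q\<close> by (metis permutes_def)
      obtain y where y: "y \<in> Q" "x \<cdot> a \<cdot> y = t" by (rule left_divide[OF closed[OF \<open>x \<in> Q\<close> a] t(1)])
      have "w \<cdot> H (x \<cdot> a) = K y"
        using law[of "x \<cdot> a" y] that t y in_Q by simp
      also have "\<dots> = K (a \<cdot> y) \<cdot> H a" using law a y by simp
      also have "K (a \<cdot> y) = K (x \<cdot> a \<cdot> y) \<cdot> H x"
        using law[of x "a \<cdot> y"] middle_nucleusD[OF \<open>a \<in> Nm\<close>] that y in_Q by simp
      finally show ?thesis using t y by simp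
    qed
    have hom: "H (x \<cdot> a) = H x \<cdot> H a" if "x \<in> Q" for x
      using mult[OF one_closed that] in_Q that by (simp add: left_one)
    show "H a \<in> Q" using in_Q by simp
    fix w v assume wv: "w \<in> Q" "v \<in> Q"
    obtain x where x: "x \<in> Q" "H x = v"
      using H \<open>v \<in> Q\<close> by (metis permutes_def)
    show "w \<cdot> v \<cdot> H a = w \<cdot> (v \<cdot> H a)"
      using mult[OF wv(1) x(1)] hom[OF x(1)] x by simp
  qed
next
  note in_Q = permutes_in_image[OF K] permutes_in_image[OF H] closed a one_closed
  assume Ha: "H a \<in> Nr"
  \<comment> \<open>Compare the law at \<open>y = e\<close> for the product with its iteration over the two factors.\<close>
  have hom: "H (x \<cdot> a) = H x \<cdot> H a" if x: "x \<in> Q" for x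
  proof -
    have "K (x \<cdot> a) \<cdot> (H x \<cdot> H a) = K (x \<cdot> a) \<cdot> H x \<cdot> H a"
      using right_nucleusD[OF Ha] in_Q x by simp
    also have "\<dots> = K (a \<cdot> e) \<cdot> H a" using law a x by (simp add: right_one)
    also have "\<dots> = K e" by (rule law[OF a one_closed])
    also have "\<dots> = K (x \<cdot> a \<cdot> e) \<cdot> H (x \<cdot> a)" using law in_Q x by simp
    also have "\<dots> = K (x \<cdot> a) \<cdot> H (x \<cdot> a)" using in_Q x by (simp add: right_one)
    finally show ?thesis using left_cancel in_Q x by metis
  qed
  show "a \<in> Nm"
  proof (rule middle_nucleusI[OF a])
    fix x y assume xy: "x \<in> Q" "y \<in> Q"
    have "K (x \<cdot> (a \<cdot> y)) \<cdot> H (x \<cdot> a) = K (x \<cdot> (a \<cdot> y)) \<cdot> H x \<cdot> H a"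
      using right_nucleusD[OF Ha] hom in_Q xy by simp
    also have "\<dots> = K (x \<cdot> a \<cdot> y) \<cdot> H (x \<cdot> a)" using law in_Q xy by simp
    finally have "K (x \<cdot> (a \<cdot> y)) = K (x \<cdot> a \<cdot> y)"
      using right_cancel in_Q xy by metis
    then show "x \<cdot> a \<cdot> y = x \<cdot> (a \<cdot> y)" using permutes_inj[OF K] by (metis injD)
  qed
qed

lemma nuclei_eq:
  assumes "K permutes Q" "H permutes Q" "H e = e"
    and "\<And>x y. x \<in> Q \<Longrightarrow> y \<in> Q \<Longrightarrow> K (x \<cdot> y) \<cdot> H x = K y"
    and Nm: "\<And>a. a \<in> Q \<Longrightarrow> H a \<in> Nm \<longleftrightarrow> a \<in> Nm"
    and Nr: "\<And>a. a \<in> Q \<Longrightarrow> H a \<in> Nr \<longleftrightarrow> a \<in> Nr"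
  shows "Nl = Nr" "Nr = Nm"
proof -
  have "a \<in> Nl \<longleftrightarrow> a \<in> Nm" "a \<in> Nm \<longleftrightarrow> a \<in> Nr" if "a \<in> Q" for a
    using left_nucleus_iff_middle[where K = K and H = H, OF assms(1-4) that] Nm[OF that]
      middle_nucleus_iff_right[where K = K and H = H, OF assms(1-4) that] Nr[OF that] by simp_all
  then show "Nl = Nr" "Nr = Nm"
    using left_nucleus_in right_nucleus_in middle_nucleus_in by blast+
qed

lemma WIP_nuclei_eq:
  assumes "J permutes Q" "\<And>x y. x \<in> Q \<Longrightarrow> y \<in> Q \<Longrightarrow> J (x \<cdot> y) \<cdot> x = J y"
  shows "Nl = Nr" "Nr = Nm"
  using nuclei_eq[of J id] assms by (simp_all add: permutes_id)

lemma perm_pow_permutes: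
  assumes "J permutes Q" shows "perm_pow J k permutes Q"
proof -
  have "(f ^^ n) permutes Q" if "f permutes Q" for f :: "'a \<Rightarrow> 'a" and n
    using that by (induction n) (auto intro: permutes_compose permutes_id)
  then show ?thesis using assms permutes_inv by (auto simp: perm_pow_def)
qed

lemma perm_pow_mem_iff:
  assumes "J permutes Q" and "\<And>x. x \<in> Q \<Longrightarrow> J x \<in> N \<longleftrightarrow> x \<in> N" and "x \<in> Q"
  shows "perm_pow J k x \<in> N \<longleftrightarrow> x \<in> N"
proof -
  have inv: "inv J x \<in> N \<longleftrightarrow> x \<in> N" if "x \<in> Q" for x
    using assms(2)[of "inv J x"] that permutes_inverses(1)[OF assms(1)]
      permutes_in_image[OF permutes_inv[OF assms(1)]] by simp
  have "(f ^^ n) x \<in> Q \<and> ((f ^^ n) x \<in> N \<longleftrightarrow> x \<in> N)"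
    if "f permutes Q" "\<And>x. x \<in> Q \<Longrightarrow> f x \<in> N \<longleftrightarrow> x \<in> N" for f n
    by (induction n) (simp_all add: assms(3) that permutes_in_image[OF that(1)])
  then show ?thesis
    using assms inv permutes_inv[OF assms(1)] by (simp add: perm_pow_def)
qed

lemma m_inverse_nuclei_eq:
  assumes "m_inverse_loop Q mul e m Ir"
  shows "Nl = Nr" "Nr = Nm"
proof -
  note Ir = right_inverse_map_permutes
  have law: "\<And>x y. x \<in> Q \<Longrightarrow> y \<in> Q \<Longrightarrow>
      perm_pow Ir m (x \<cdot> y) \<cdot> perm_pow Ir (m + 1) x = perm_pow Ir m y"
    using assms by (simp add: m_inverse_loop_def)
  have "Ir x \<in> {e} \<longleftrightarrow> x \<in> {e}" if "x \<in> Q" for x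
    using right_inverse_map_one permutes_inj[OF Ir] by (metis injD singleton_iff)
  from perm_pow_mem_iff[OF Ir this one_closed]
  have one: "perm_pow Ir (m + 1) e = e" by simp
  have Nm: "Ir x \<in> Nm \<longleftrightarrow> x \<in> Nm" and Nr: "Ir x \<in> Nr \<longleftrightarrow> x \<in> Nr" if "x \<in> Q" for x
    using right_inverse_map_twice middle_nucleus_inverse right_nucleus_inverse
      permutes_inj[OF Ir] by (metis injD)+
  show "Nl = Nr" "Nr = Nm"
    using nuclei_eq[OF perm_pow_permutes[OF Ir] perm_pow_permutes[OF Ir] one law
        perm_pow_mem_iff[OF Ir Nm] perm_pow_mem_iff[OF Ir Nr]] by blast+
qed

section \<open>Components of the A-nuclei\<close>

text \<open>Translations, extended by the identity outside \<open>Q\<close> so as to be permutations of \<open>Q\<close>.\<close>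

definition left_translation :: "'a \<Rightarrow> 'a \<Rightarrow> 'a" where
  "left_translation a x = (if x \<in> Q then a \<cdot> x else x)"

definition right_translation :: "'a \<Rightarrow> 'a \<Rightarrow> 'a" where
  "right_translation a x = (if x \<in> Q then x \<cdot> a else x)"

lemma left_translation_permutes: "a \<in> Q \<Longrightarrow> left_translation a permutes Q"
proof (rule bij_imp_permutes)
  assume a: "a \<in> Q"
  have "bij_betw (mul a) Q Q"
  proof (rule bij_betw_imageI)
    show "inj_on (mul a) Q" using left_cancel[OF a] by (rule inj_onI)
    show "mul a ` Q = Q"
      using closed[OF a] left_divide[OF a] by (metis image_eqI image_subsetI subsetI subset_antisym)
  qed
  then show "bij_betw (left_translation a) Q Q"
    by (rule bij_betw_cong[THEN iffD1, rotated]) (simp add: left_translation_def)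
qed (simp add: left_translation_def)

lemma right_translation_permutes: "a \<in> Q \<Longrightarrow> right_translation a permutes Q"
proof (rule bij_imp_permutes)
  assume a: "a \<in> Q"
  have "bij_betw (\<lambda>x. x \<cdot> a) Q Q"
  proof (rule bij_betw_imageI)
    show "inj_on (\<lambda>x. x \<cdot> a) Q" using right_cancel[OF a] by (rule inj_onI)
    show "(\<lambda>x. x \<cdot> a) ` Q = Q"
      using closed[OF _ a] right_divide[OF a] by (metis image_eqI image_subsetI subsetI subset_antisym)
  qed
  then show "bij_betw (right_translation a) Q Q"
    by (rule bij_betw_cong[THEN iffD1, rotated]) (simp add: right_translation_def)
qed (simp add: right_translation_def)

lemma left_translationI:
  "f permutes Q \<Longrightarrow> (\<And>x. x \<in> Q \<Longrightarrow> f x = a \<cdot> x) \<Longrightarrow> f = left_translation a"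
  by (auto simp: left_translation_def permutes_not_in)

lemma right_translationI:
  "f permutes Q \<Longrightarrow> (\<And>x. x \<in> Q \<Longrightarrow> f x = x \<cdot> a) \<Longrightarrow> f = right_translation a"
  by (auto simp: right_translation_def permutes_not_in)

lemma left_A_nucleus_eq:
  "left_A_nucleus Q mul = {(left_translation a, id, left_translation a) | a. a \<in> Nl}"
proof (intro equalityI subsetI)
  fix t assume "t \<in> left_A_nucleus Q mul"
  then obtain \<alpha> \<gamma> where t: "t = (\<alpha>, id, \<gamma>)" and \<alpha>: "\<alpha> permutes Q" and \<gamma>: "\<gamma> permutes Q"
    and law: "\<And>x y. x \<in> Q \<Longrightarrow> y \<in> Q \<Longrightarrow> \<alpha> x \<cdot> y = \<gamma> (x \<cdot> y)"
    by (auto simp: left_A_nucleus_def autotopy_def)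
  note in_Q = permutes_in_image[OF \<alpha>] closed one_closed
  have \<gamma>_eq: "\<gamma> x = \<alpha> e \<cdot> x" if "x \<in> Q" for x
    using law[OF one_closed that] that by (simp add: left_one)
  have \<alpha>_eq: "\<alpha> x = \<alpha> e \<cdot> x" if "x \<in> Q" for x
    using law[OF that one_closed] \<gamma>_eq that in_Q by (simp add: right_one)
  have "\<alpha> e \<in> Nl"
  proof (rule left_nucleusI)
    show "\<alpha> e \<in> Q" using in_Q by simp
    fix x y assume xy: "x \<in> Q" "y \<in> Q"
    show "\<alpha> e \<cdot> x \<cdot> y = \<alpha> e \<cdot> (x \<cdot> y)"
      using law[OF xy] \<alpha>_eq[OF xy(1)] \<gamma>_eq[OF closed[OF xy]] by simp
  qed
  moreover have "\<alpha> = left_translation (\<alpha> e)" "\<gamma> = left_translation (\<alpha> e)"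
    using left_translationI \<alpha> \<gamma> \<alpha>_eq \<gamma>_eq by blast+
  ultimately show "t \<in> {(left_translation a, id, left_translation a) | a. a \<in> Nl}"
    using t by blast
next
  fix t :: "('a \<Rightarrow> 'a) \<times> ('a \<Rightarrow> 'a) \<times> ('a \<Rightarrow> 'a)"
  assume "t \<in> {(left_translation a, id, left_translation a) | a. a \<in> Nl}"
  then show "t \<in> left_A_nucleus Q mul"
    by (auto simp: left_A_nucleus_def autotopy_def left_translation_permutes permutes_id
        left_nucleus_in left_nucleusD left_translation_def closed)
qed

lemma right_A_nucleus_eq:
  "right_A_nucleus Q mul = {(id, right_translation a, right_translation a) | a. a \<in> Nr}"
proof (intro equalityI subsetI)
  fix t assume "t \<in> right_A_nucleus Q mul"
  then obtain \<beta> \<gamma> where t: "t = (id, \<beta>, \<gamma>)" and \<beta>: "\<beta> permutes Q" and \<gamma>: "\<gamma> permutes Q"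
    and law: "\<And>x y. x \<in> Q \<Longrightarrow> y \<in> Q \<Longrightarrow> x \<cdot> \<beta> y = \<gamma> (x \<cdot> y)"
    by (auto simp: right_A_nucleus_def autotopy_def)
  note in_Q = permutes_in_image[OF \<beta>] closed one_closed
  have \<gamma>_eq: "\<gamma> x = x \<cdot> \<beta> e" if "x \<in> Q" for x
    using law[OF that one_closed] that by (simp add: right_one)
  have \<beta>_eq: "\<beta> x = x \<cdot> \<beta> e" if "x \<in> Q" for x
    using law[OF one_closed that] \<gamma>_eq that in_Q by (simp add: left_one)
  have "\<beta> e \<in> Nr"
  proof (rule right_nucleusI)
    show "\<beta> e \<in> Q" using in_Q by simp
    fix x y assume xy: "x \<in> Q" "y \<in> Q"
    show "x \<cdot> y \<cdot> \<beta> e = x \<cdot> (y \<cdot> \<beta> e)"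
      using law[OF xy] \<beta>_eq[OF xy(2)] \<gamma>_eq[OF closed[OF xy]] by simp
  qed
  moreover have "\<beta> = right_translation (\<beta> e)" "\<gamma> = right_translation (\<beta> e)"
    using right_translationI \<beta> \<gamma> \<beta>_eq \<gamma>_eq by blast+
  ultimately show "t \<in> {(id, right_translation a, right_translation a) | a. a \<in> Nr}"
    using t by blast
next
  fix t :: "('a \<Rightarrow> 'a) \<times> ('a \<Rightarrow> 'a) \<times> ('a \<Rightarrow> 'a)"
  assume "t \<in> {(id, right_translation a, right_translation a) | a. a \<in> Nr}"
  then show "t \<in> right_A_nucleus Q mul"
    by (auto simp: right_A_nucleus_def autotopy_def right_translation_permutes permutes_id
        right_nucleus_in right_nucleusD right_translation_def closed)
qed

lemma middle_A_nucleus_eq: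
  "middle_A_nucleus Q mul = {(right_translation (Ir a), left_translation a, id) | a. a \<in> Nm}"
proof (intro equalityI subsetI)
  fix t assume "t \<in> middle_A_nucleus Q mul"
  then obtain \<alpha> \<beta> where t: "t = (\<alpha>, \<beta>, id)" and \<alpha>: "\<alpha> permutes Q" and \<beta>: "\<beta> permutes Q"
    and law: "\<And>x y. x \<in> Q \<Longrightarrow> y \<in> Q \<Longrightarrow> \<alpha> x \<cdot> \<beta> y = x \<cdot> y"
    by (auto simp: middle_A_nucleus_def autotopy_def)
  note in_Q = permutes_in_image[OF \<alpha>] permutes_in_image[OF \<beta>] closed one_closed
  have \<alpha>\<beta>: "w \<cdot> \<beta> y = w \<cdot> \<beta> e \<cdot> y" if "w \<in> Q" "y \<in> Q" for w y
  proof -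
    \<comment> \<open>The law at \<open>e\<close> shows that right multiplication by \<open>\<beta> e\<close> inverts \<open>\<alpha>\<close>.\<close>
    obtain x where x: "x \<in> Q" "\<alpha> x = w"
      using \<alpha> \<open>w \<in> Q\<close> by (metis permutes_def)
    have "w \<cdot> \<beta> e = x" using law[OF x(1) one_closed] x by (simp add: right_one)
    then show ?thesis using law[OF x(1) that(2)] x by simp
  qed
  have \<beta>_eq: "\<beta> y = \<beta> e \<cdot> y" if "y \<in> Q" for y
    using \<alpha>\<beta>[OF one_closed that] that in_Q by (simp add: left_one)
  have Nm: "\<beta> e \<in> Nm"
  proof (rule middle_nucleusI)
    show "\<beta> e \<in> Q" using in_Q by simp
    fix x y assume xy: "x \<in> Q" "y \<in> Q"
    show "x \<cdot> \<beta> e \<cdot> y = x \<cdot> (\<beta> e \<cdot> y)"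
      using \<alpha>\<beta>[OF xy] \<beta>_eq[OF xy(2)] by simp
  qed
  have \<alpha>_eq: "\<alpha> x = x \<cdot> Ir (\<beta> e)" if "x \<in> Q" for x
  proof -
    have b: "Ir (\<beta> e) \<in> Q" "\<beta> e \<cdot> Ir (\<beta> e) = e"
      using right_inverse_map_in in_Q by auto
    have "x \<cdot> Ir (\<beta> e) = \<alpha> x \<cdot> (\<beta> e \<cdot> Ir (\<beta> e))"
      using law[OF that b(1)] \<beta>_eq[OF b(1)] by simp
    then show ?thesis using b in_Q that by (simp add: right_one)
  qed
  have "\<alpha> = right_translation (Ir (\<beta> e))" "\<beta> = left_translation (\<beta> e)"
    using left_translationI right_translationI \<alpha> \<beta> \<alpha>_eq \<beta>_eq by blast+
  then show "t \<in> {(right_translation (Ir a), left_translation a, id) | a. a \<in> Nm}"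
    using t Nm by blast
next
  fix t :: "('a \<Rightarrow> 'a) \<times> ('a \<Rightarrow> 'a) \<times> ('a \<Rightarrow> 'a)"
  assume "t \<in> {(right_translation (Ir a), left_translation a, id) | a. a \<in> Nm}"
  then obtain a where t: "t = (right_translation (Ir a), left_translation a, id)" and a: "a \<in> Nm"
    by blast
  have in_Q: "a \<in> Q" "Ir a \<in> Q" "Ir a \<cdot> a = e"
    using a middle_nucleus_in right_inverse_map_in middle_nucleus_left_inverse by auto
  have "x \<cdot> Ir a \<cdot> (a \<cdot> y) = x \<cdot> y" if "x \<in> Q" "y \<in> Q" for x y
  proof -
    have "x \<cdot> Ir a \<cdot> (a \<cdot> y) = x \<cdot> Ir a \<cdot> a \<cdot> y"
      using middle_nucleusD[OF a] that in_Q closed by simp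
    also have "x \<cdot> Ir a \<cdot> a = x"
      using middle_nucleusD[OF middle_nucleus_inverse[OF a]] that in_Q
      by (simp add: right_one)
    finally show ?thesis .
  qed
  then show "t \<in> middle_A_nucleus Q mul"
    using t in_Q by (auto simp: middle_A_nucleus_def autotopy_def left_translation_permutes
        right_translation_permutes permutes_id left_translation_def right_translation_def)
qed

lemma A_nucleus_components:
  "comp1 (left_A_nucleus Q mul) = left_translation ` Nl"
  "comp3 (left_A_nucleus Q mul) = left_translation ` Nl"
  "comp2 (right_A_nucleus Q mul) = right_translation ` Nr"
  "comp3 (right_A_nucleus Q mul) = right_translation ` Nr"
  "comp2 (middle_A_nucleus Q mul) = left_translation ` Nm"
  by (force simp: comp1_def comp2_def comp3_def left_A_nucleus_eq right_A_nucleus_eq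
      middle_A_nucleus_eq)+

lemma comp1_middle_A_nucleus: "comp1 (middle_A_nucleus Q mul) = right_translation ` Nm"
proof -
  have "Ir ` Nm = Nm"
    using middle_nucleus_inverse right_inverse_map_twice by force
  moreover have "comp1 (middle_A_nucleus Q mul) = right_translation ` Ir ` Nm"
    by (force simp: comp1_def middle_A_nucleus_eq)
  ultimately show ?thesis by simp
qed

section \<open>Central nuclei\<close>

lemma CI_map_eq_right_inverse_map:
  assumes J: "J permutes Q" and law: "\<And>x y. x \<in> Q \<Longrightarrow> y \<in> Q \<Longrightarrow> x \<cdot> y \<cdot> J x = y"
  shows "J = Ir"
proof
  fix x show "J x = Ir x"
  proof (cases "x \<in> Q")
    case True
    then have "x \<cdot> J x = e" using law[OF True one_closed] by (simp add: right_one)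
    then show ?thesis
      using right_inverse_map_eqI True permutes_in_image[OF J] by metis
  next
    case False
    then show ?thesis using J by (simp add: right_inverse_map_def permutes_not_in)
  qed
qed

lemma CI_imp_0_inverse:
  assumes "\<And>x y. x \<in> Q \<Longrightarrow> y \<in> Q \<Longrightarrow> x \<cdot> y \<cdot> Ir x = y"
  shows "m_inverse_loop Q mul e 0 Ir"
  using assms right_inverse_map_permutes loop_axioms
  by (simp add: m_inverse_loop_def perm_pow_def)

lemma CI_nucleus_commutes:
  assumes law: "\<And>x y. x \<in> Q \<Longrightarrow> y \<in> Q \<Longrightarrow> x \<cdot> y \<cdot> Ir x = y"
    and a: "a \<in> Nr" and x: "x \<in> Q"
  shows "a \<cdot> x = x \<cdot> a"
proof -
  have in_Q: "a \<in> Q" "Ir a \<in> Q" "a \<cdot> Ir a = e"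
    using a right_nucleus_in right_inverse_map_in by auto
  have "x \<cdot> a \<cdot> Ir a = x"
    using right_nucleusD[OF right_nucleus_inverse[OF a]] in_Q x by (simp add: right_one)
  also have "\<dots> = a \<cdot> x \<cdot> Ir a" using law in_Q x by simp
  finally show ?thesis using right_cancel in_Q x closed by metis
qed

lemma central_nucleus_normal:
  assumes eq: "Nl = Nm" and comm: "\<And>a x. a \<in> Nm \<Longrightarrow> x \<in> Q \<Longrightarrow> a \<cdot> x = x \<cdot> a"
  shows "normal_subloop Q mul e Nm"
proof -
  \<comment> \<open>The classes of \<open>\<theta>\<close> are the cosets of the nucleus.\<close>
  define \<theta> where "\<theta> = {(x, y). x \<in> Q \<and> y \<in> Q \<and> (\<exists>n\<in>Nm. y = n \<cdot> x)}"
  have N_in: "n \<in> Q" if "n \<in> Nm" for n using that middle_nucleus_in by blast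
  have lassoc: "n \<cdot> x \<cdot> y = n \<cdot> (x \<cdot> y)" if "n \<in> Nm" "x \<in> Q" "y \<in> Q" for n x y
    using left_nucleusD that eq by blast
  have shift: "n \<cdot> (z \<cdot> x) = z \<cdot> (n \<cdot> x)" if "n \<in> Nm" "x \<in> Q" "z \<in> Q" for n x z
  proof -
    have "n \<cdot> (z \<cdot> x) = z \<cdot> n \<cdot> x" using lassoc comm that by metis
    then show ?thesis using middle_nucleusD that by simp
  qed
  have "equiv Q \<theta>"
  proof (rule equivI)
    show "\<theta> \<subseteq> Q \<times> Q" by (auto simp: \<theta>_def)
    show "refl_on Q \<theta>"
      using one_in_left_nucleus eq by (auto simp: refl_on_def \<theta>_def left_one intro!: bexI[of _ e])
    show "sym \<theta>"
    proof (rule symI)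
      fix x y assume "(x, y) \<in> \<theta>"
      then obtain n where n: "x \<in> Q" "y \<in> Q" "n \<in> Nm" "y = n \<cdot> x" by (auto simp: \<theta>_def)
      have n': "Ir n \<in> Nm" "Ir n \<cdot> n = e"
        using n middle_nucleus_inverse middle_nucleus_left_inverse by auto
      have "x = Ir n \<cdot> y" using lassoc[OF n'(1) N_in[OF n(3)] n(1)] n n' by (simp add: left_one)
      then show "(y, x) \<in> \<theta>" unfolding \<theta>_def using n n'(1) by blast
    qed
    show "trans \<theta>"
    proof (rule transI)
      fix x y z assume "(x, y) \<in> \<theta>" "(y, z) \<in> \<theta>"
      then obtain n k where *: "x \<in> Q" "z \<in> Q" "n \<in> Nm" "k \<in> Nm" "z = k \<cdot> (n \<cdot> x)"
        by (auto simp: \<theta>_def)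
      have "k \<cdot> n \<in> Nm" using left_nucleus_closed eq * by blast
      moreover have "z = k \<cdot> n \<cdot> x" using lassoc N_in * by simp
      ultimately show "(x, z) \<in> \<theta>" unfolding \<theta>_def using * by blast
    qed
  qed
  moreover have "(x, y) \<in> \<theta> \<longleftrightarrow> (z \<cdot> x, z \<cdot> y) \<in> \<theta>"
    and "(x, y) \<in> \<theta> \<longleftrightarrow> (x \<cdot> z, y \<cdot> z) \<in> \<theta>" if "x \<in> Q" "y \<in> Q" "z \<in> Q" for x y z
  proof -
    have "y = n \<cdot> x \<longleftrightarrow> z \<cdot> y = n \<cdot> (z \<cdot> x)" if "n \<in> Nm" for n
      using shift[OF that] left_cancel closed N_in \<open>x \<in> Q\<close> \<open>y \<in> Q\<close> \<open>z \<in> Q\<close> that by metis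
    then show "(x, y) \<in> \<theta> \<longleftrightarrow> (z \<cdot> x, z \<cdot> y) \<in> \<theta>"
      using that closed by (auto simp: \<theta>_def)
    have "y = n \<cdot> x \<longleftrightarrow> y \<cdot> z = n \<cdot> (x \<cdot> z)" if "n \<in> Nm" for n
      using lassoc[OF that] right_cancel closed N_in \<open>x \<in> Q\<close> \<open>y \<in> Q\<close> \<open>z \<in> Q\<close> that by metis
    then show "(x, y) \<in> \<theta> \<longleftrightarrow> (x \<cdot> z, y \<cdot> z) \<in> \<theta>"
      using that closed by (auto simp: \<theta>_def)
  qed
  ultimately have "normal_congruence Q mul \<theta>"
    unfolding normal_congruence_def by blast
  moreover have "Nm = \<theta> `` {e}"
    using N_in one_closed by (auto simp: \<theta>_def right_one)
  ultimately show ?thesis unfolding normal_subloop_def by blast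
qed

end

section \<open>The three classes of loops\<close>

theorem theorem4p42:
  fixes Q :: "'a set" and mul :: "'a \<Rightarrow> 'a \<Rightarrow> 'a" and e :: 'a
  shows
    "(\<forall>m::int. m_inverse_loop Q mul e m (right_inverse_map Q mul e) \<longrightarrow>
        left_nucleus Q mul = right_nucleus Q mul \<and>
        right_nucleus Q mul = middle_nucleus Q mul)
     \<and>
     (WIP_loop Q mul e \<longrightarrow>
        comp1 (left_A_nucleus Q mul) = comp3 (left_A_nucleus Q mul) \<and>
        comp3 (left_A_nucleus Q mul) = comp2 (middle_A_nucleus Q mul) \<and>
        comp2 (right_A_nucleus Q mul) = comp3 (right_A_nucleus Q mul) \<and>
        comp3 (right_A_nucleus Q mul) = comp1 (middle_A_nucleus Q mul) \<and>
        left_nucleus Q mul = right_nucleus Q mul \<and>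
        right_nucleus Q mul = middle_nucleus Q mul)
     \<and>
     (CI_loop Q mul e \<longrightarrow>
        comp1 (left_A_nucleus Q mul) = comp3 (left_A_nucleus Q mul) \<and>
        comp3 (left_A_nucleus Q mul) = comp2 (middle_A_nucleus Q mul) \<and>
        comp2 (middle_A_nucleus Q mul) = comp2 (right_A_nucleus Q mul) \<and>
        comp2 (right_A_nucleus Q mul) = comp3 (right_A_nucleus Q mul) \<and>
        comp3 (right_A_nucleus Q mul) = comp1 (middle_A_nucleus Q mul) \<and>
        left_nucleus Q mul = right_nucleus Q mul \<and>
        right_nucleus Q mul = middle_nucleus Q mul \<and>
        normal_subloop Q mul e (middle_nucleus Q mul))"
proof (rule conjI[OF _ conjI])
  show "\<forall>m::int. m_inverse_loop Q mul e m (right_inverse_map Q mul e) \<longrightarrow>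
      left_nucleus Q mul = right_nucleus Q mul \<and> right_nucleus Q mul = middle_nucleus Q mul"
  proof (intro allI impI)
    fix m assume m: "m_inverse_loop Q mul e m (right_inverse_map Q mul e)"
    then interpret loop Q mul e by (simp add: m_inverse_loop_def)
    show "Nl = Nr \<and> Nr = Nm" using m_inverse_nuclei_eq[OF m] by simp
  qed
next
  show "WIP_loop Q mul e \<longrightarrow>
        comp1 (left_A_nucleus Q mul) = comp3 (left_A_nucleus Q mul) \<and>
        comp3 (left_A_nucleus Q mul) = comp2 (middle_A_nucleus Q mul) \<and>
        comp2 (right_A_nucleus Q mul) = comp3 (right_A_nucleus Q mul) \<and>
        comp3 (right_A_nucleus Q mul) = comp1 (middle_A_nucleus Q mul) \<and>
        left_nucleus Q mul = right_nucleus Q mul \<and>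
        right_nucleus Q mul = middle_nucleus Q mul"
  proof
    assume "WIP_loop Q mul e"
    then obtain J where "loop Q mul e" and J: "J permutes Q"
      and law: "\<And>x y. x \<in> Q \<Longrightarrow> y \<in> Q \<Longrightarrow> mul (J (mul x y)) x = J y"
      by (auto simp: WIP_loop_def)
    interpret loop Q mul e by fact
    show "comp1 (left_A_nucleus Q mul) = comp3 (left_A_nucleus Q mul) \<and>
        comp3 (left_A_nucleus Q mul) = comp2 (middle_A_nucleus Q mul) \<and>
        comp2 (right_A_nucleus Q mul) = comp3 (right_A_nucleus Q mul) \<and>
        comp3 (right_A_nucleus Q mul) = comp1 (middle_A_nucleus Q mul) \<and>
        Nl = Nr \<and> Nr = Nm"
      using WIP_nuclei_eq[OF J law] by (simp add: A_nucleus_components comp1_middle_A_nucleus)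
  qed
next
  show "CI_loop Q mul e \<longrightarrow>
        comp1 (left_A_nucleus Q mul) = comp3 (left_A_nucleus Q mul) \<and>
        comp3 (left_A_nucleus Q mul) = comp2 (middle_A_nucleus Q mul) \<and>
        comp2 (middle_A_nucleus Q mul) = comp2 (right_A_nucleus Q mul) \<and>
        comp2 (right_A_nucleus Q mul) = comp3 (right_A_nucleus Q mul) \<and>
        comp3 (right_A_nucleus Q mul) = comp1 (middle_A_nucleus Q mul) \<and>
        left_nucleus Q mul = right_nucleus Q mul \<and>
        right_nucleus Q mul = middle_nucleus Q mul \<and>
        normal_subloop Q mul e (middle_nucleus Q mul)"
  proof
    assume "CI_loop Q mul e"
    then obtain J where "loop Q mul e" and J: "J permutes Q"
      and J_law: "\<And>x y. x \<in> Q \<Longrightarrow> y \<in> Q \<Longrightarrow> mul (mul x y) (J x) = y"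
      by (auto simp: CI_loop_def)
    interpret loop Q mul e by fact
    have law: "\<And>x y. x \<in> Q \<Longrightarrow> y \<in> Q \<Longrightarrow> mul (mul x y) (Ir x) = y"
      using J_law CI_map_eq_right_inverse_map[OF J J_law] by simp
    have eq: "Nl = Nr" "Nr = Nm"
      using m_inverse_nuclei_eq[OF CI_imp_0_inverse[OF law]] by blast+
    have comm: "\<And>a x. a \<in> Nm \<Longrightarrow> x \<in> Q \<Longrightarrow> mul a x = mul x a"
      using CI_nucleus_commutes[OF law] eq by blast
    have "left_translation ` Nm = right_translation ` Nm"
      by (rule image_cong) (auto simp: fun_eq_iff left_translation_def right_translation_def intro: comm)
    moreover have "normal_subloop Q mul e Nm"
      using central_nucleus_normal[OF _ comm] eq by blast
    ultimately show "comp1 (left_A_nucleus Q mul) = comp3 (left_A_nucleus Q mul) \<and>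
        comp3 (left_A_nucleus Q mul) = comp2 (middle_A_nucleus Q mul) \<and>
        comp2 (middle_A_nucleus Q mul) = comp2 (right_A_nucleus Q mul) \<and>
        comp2 (right_A_nucleus Q mul) = comp3 (right_A_nucleus Q mul) \<and>
        comp3 (right_A_nucleus Q mul) = comp1 (middle_A_nucleus Q mul) \<and>
        Nl = Nr \<and> Nr = Nm \<and> normal_subloop Q mul e Nm"
      using eq by (simp add: A_nucleus_components comp1_middle_A_nucleus)
  qed
qed

end
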